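(* Let $\mathcal{M}=h\mathcal{K}_u$ be a nearly $S^*$-invariant subspace. For $f\in\mathcal{M}^\perp$, the generalized dual shift $D_z^{\mathcal{M}}=P_{\mathcal{M}^\perp}M_z|_{\mathcal{M}^\perp}$ is given by $$D_z^{\mathcal{M}}f=zf-\langle f,\bar z h\rangle h+\langle f,\bar z hu\rangle hu.$$
   Context: $\mathbb{D}$ is the open unit disk, $\mathbb{T}=\partial\mathbb{D}$, and $L^2(\mathbb{T})$ is taken with respect to normalized Lebesgue measure $m$, with inner product $\langle\cdot,\cdot\rangle$ linear in the first variable. $H^2\subset L^2(\mathbb{T})$ is the Hardy space (functions with vanishing negative Fourier coefficients, also viewed as analytic functions on $\mathbb{D}$). For $f\in H^2$, $S^*f=(f-f(0))/z$. For an inner function $u$, $\mathcal{K}_u=H^2\ominus uH^2$. A closed subspace $\mathcal{M}\subset H^2$ is nearly $S^*$-invariant if $f\in\mathcal{M}$, $f(0)=0$ imply $S^*f\in\mathcal{M}$. In writing $\mathcal{M}=h\mathcal{K}_u$ it is understood that $\mathcal{M}$ is nonzero, proper and closed, $u$ is a nonconstant inner function with $u(0)=0$, and $h\in\mathcal{M}$ is the extremal function of $\mathcal{M}$: $\|h\|_2=1$, $h(0)>0$, $h\perp\{f\in\mathcal{M}:f(0)=0\}$, and multiplication by $h$ is an isometry from $\mathcal{K}_u$ onto $\mathcal{M}$. $\mathcal{M}^\perp=L^2(\mathbb{T})\ominus\mathcal{M}$, $P_{\mathcal{M}^\perp}$ is the orthogonal projection of $L^2(\mathbb{T})$ onto it,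 and $M_z$ is multiplication by $z$ on $L^2(\mathbb{T})$. *)

theory Defs
  imports "HOL-Analysis.Analysis"
begin

text \<open>
  Elements of \<open>L\<^sup>2(\<T>)\<close> are represented by functions \<open>complex \<Rightarrow> complex\<close>, of which only the
  values on the unit circle matter; equality in \<open>L\<^sup>2(\<T>)\<close> is equality almost everywhere
  with respect to \<open>circle_measure\<close>, the normalized Lebesgue measure \<open>m\<close>, whose space is
  the unit circle.
\<close>

definition circle_measure :: "complex measure" where
  "circle_measure =
     distr (uniform_measure lborel {0..<2 * pi}) (restrict_space borel (sphere 0 1)) cis"

lemma space_circle_measure: "space circle_measure = sphere 0 1"
  by (simp add: circle_measure_def space_restrict_space)

lemma emeasure_circle_measure: "emeasure circle_measure (sphere 0 1) = 1"
proof -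
  have "cis \<in> uniform_measure lborel {0..<2 * pi} \<rightarrow>\<^sub>M restrict_space borel (sphere 0 1)"
    by (rule measurable_restrict_space2)
       (auto intro!: borel_measurable_continuous_onI continuous_intros
             simp: measurable_cong_sets[OF sets_uniform_measure refl])
  moreover have "sphere 0 1 \<in> sets (restrict_space borel (sphere (0::complex) 1))"
    using sets.top[of "restrict_space borel (sphere (0::complex) 1)"]
    by (simp add: space_restrict_space)
  moreover have "cis -` sphere 0 1 \<inter> UNIV = UNIV"
    by auto
  ultimately show ?thesis
    by (simp add: circle_measure_def emeasure_distr emeasure_uniform_measure ennreal_divide_self)
qed

definition L2T :: "(complex \<Rightarrow> complex) set" where
  "L2T = {f. f \<in> borel_measurable circle_measure \<and>
             integrable circle_measure (\<lambda>z. (norm (f z))\<^sup>2)}"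

definition innerT :: "(complex \<Rightarrow> complex) \<Rightarrow> (complex \<Rightarrow> complex) \<Rightarrow> complex" where
  "innerT f g = (LINT z|circle_measure. f z * cnj (g z))"

definition normT :: "(complex \<Rightarrow> complex) \<Rightarrow> real" where
  "normT f = sqrt (LINT z|circle_measure. (norm (f z))\<^sup>2)"

definition eqT :: "(complex \<Rightarrow> complex) \<Rightarrow> (complex \<Rightarrow> complex) \<Rightarrow> bool" where
  "eqT f g \<longleftrightarrow> (AE z in circle_measure. f z = g z)"

definition orthT ::
  "(complex \<Rightarrow> complex) set \<Rightarrow> (complex \<Rightarrow> complex) set \<Rightarrow> (complex \<Rightarrow> complex) set"
  (infixl "\<ominus>\<^sub>T" 65) where
  "A \<ominus>\<^sub>T B = {f \<in> A. \<forall>g\<in>B. innerT f g = 0}"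

text \<open>
  Closedness with respect to \<open>normT\<close>, applied to constant sequences, makes such a set
  invariant under changing representatives on null sets.
\<close>

definition closed_subspaceT :: "(complex \<Rightarrow> complex) set \<Rightarrow> bool" where
  "closed_subspaceT M \<longleftrightarrow>
     M \<subseteq> L2T \<and> (\<lambda>z. 0) \<in> M \<and>
     (\<forall>f\<in>M. \<forall>g\<in>M. (\<lambda>z. f z + g z) \<in> M) \<and>
     (\<forall>c. \<forall>f\<in>M. (\<lambda>z. c * f z) \<in> M) \<and>
     (\<forall>F f. (\<forall>n::nat. F n \<in> M) \<longrightarrow> f \<in> L2T \<longrightarrow>
        (\<lambda>n. normT (\<lambda>z. F n z - f z)) \<longlonglongrightarrow> 0 \<longrightarrow> f \<in> M)"

text \<open>
  The orthogonal projection onto a closed subspace \<open>N\<close>. It is determined only up to a null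
  set; the choice operator picks a representative.
\<close>

definition projT ::
  "(complex \<Rightarrow> complex) set \<Rightarrow> (complex \<Rightarrow> complex) \<Rightarrow> (complex \<Rightarrow> complex)" where
  "projT N g = (SOME p. p \<in> N \<and> (\<forall>q\<in>N. innerT (\<lambda>z. g z - p z) q = 0))"

definition fourierT :: "(complex \<Rightarrow> complex) \<Rightarrow> int \<Rightarrow> complex" where
  "fourierT f n = innerT f (\<lambda>z. z powi n)"

definition H2 :: "(complex \<Rightarrow> complex) set" where
  "H2 = {f \<in> L2T. \<forall>n<0. fourierT f n = 0}"

text \<open>
  The analytic function on the open unit disk associated with \<open>f \<in> H2\<close>. A value \<open>f(0)\<close> always
  means \<open>disk_ext f 0\<close>, not the (irrelevant) value at 0 of the representative \<open>f\<close>.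
\<close>

definition disk_ext :: "(complex \<Rightarrow> complex) \<Rightarrow> complex \<Rightarrow> complex" where
  "disk_ext f w = (\<Sum>n. fourierT f (int n) * w ^ n)"

definition backward_shift :: "(complex \<Rightarrow> complex) \<Rightarrow> (complex \<Rightarrow> complex)" where
  "backward_shift f = (\<lambda>z. (f z - disk_ext f 0) / z)"

text \<open>
  A unimodular function in \<open>H2\<close> is bounded, so it is automatically in \<open>H\<^sup>\<infinity>\<close>.
\<close>

definition inner_function :: "(complex \<Rightarrow> complex) \<Rightarrow> bool" where
  "inner_function u \<longleftrightarrow> u \<in> H2 \<and> (AE z in circle_measure. norm (u z) = 1)"

definition model_space :: "(complex \<Rightarrow> complex) \<Rightarrow> (complex \<Rightarrow> complex) set" where
  "model_space u = H2 \<ominus>\<^sub>T {(\<lambda>z. u z * g z) | g. g \<in> H2}"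

definition nearly_invariant :: "(complex \<Rightarrow> complex) set \<Rightarrow> bool" where
  "nearly_invariant M \<longleftrightarrow>
     closed_subspaceT M \<and> M \<subseteq> H2 \<and>
     (\<forall>f\<in>M. disk_ext f 0 = 0 \<longrightarrow> backward_shift f \<in> M)"

definition extremal_function :: "(complex \<Rightarrow> complex) set \<Rightarrow> (complex \<Rightarrow> complex) \<Rightarrow> bool" where
  "extremal_function M h \<longleftrightarrow>
     h \<in> M \<and> normT h = 1 \<and>
     disk_ext h 0 \<in> \<real> \<and> Re (disk_ext h 0) > 0 \<and>
     (\<forall>f\<in>M. disk_ext f 0 = 0 \<longrightarrow> innerT h f = 0)"

text \<open>
  The representation \<open>M = h K\<^sub>u\<close>, with all the conventions attached to this notation. Since
  multiplication by \<open>h\<close> is linear, being an isometry means preserving the norm.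
\<close>

definition hK_representation ::
  "(complex \<Rightarrow> complex) set \<Rightarrow> (complex \<Rightarrow> complex) \<Rightarrow> (complex \<Rightarrow> complex) \<Rightarrow> bool" where
  "hK_representation M h u \<longleftrightarrow>
     closed_subspaceT M \<and> (\<exists>f\<in>M. \<not> eqT f (\<lambda>z. 0)) \<and> M \<subset> H2 \<and>
     inner_function u \<and> \<not> (\<exists>c. eqT u (\<lambda>z. c)) \<and> disk_ext u 0 = 0 \<and>
     extremal_function M h \<and>
     (\<forall>k\<in>model_space u. (\<lambda>z. h z * k z) \<in> M \<and> normT (\<lambda>z. h z * k z) = normT k) \<and>
     (\<forall>f\<in>M. \<exists>k\<in>model_space u. eqT f (\<lambda>z. h z * k z))"

definition dual_shift ::
  "(complex \<Rightarrow> complex) set \<Rightarrow> (complex \<Rightarrow> complex) \<Rightarrow> (complex \<Rightarrow> complex)" where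
  "dual_shift M f = projT (L2T \<ominus>\<^sub>T M) (\<lambda>z. z * f z)"

end

theory Submission
  imports Defs
begin

text \<open>
  The last term of the formula vanishes. Since \<open>u(0) = 0\<close>, the function \<open>cnj z u = S\<^sup>* u\<close>
  lies in \<open>\<K>\<^sub>u\<close>, hence \<open>cnj z h u\<close> lies in \<open>\<M>\<close> and is orthogonal to \<open>f\<close>. What has to be shown is
  therefore that the projection of \<open>z f\<close> onto \<open>\<M>\<close> is \<open>\<langle>f, cnj z h\<rangle> h\<close>.

  To see this, split \<open>m \<in> \<M>\<close> as \<open>m = c h + m\<^sub>1\<close> with \<open>c = m(0) / h(0)\<close>, so that \<open>m\<^sub>1 \<in> \<M>\<close> and
  \<open>m\<^sub>1(0) = 0\<close>. Near invariance puts \<open>cnj z m\<^sub>1 = S\<^sup>* m\<^sub>1\<close> in \<open>\<M>\<close>, so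
  \<open>\<langle>z f, m\<^sub>1\<rangle> = \<langle>f, cnj z m\<^sub>1\<rangle> = 0\<close>; extremality gives \<open>\<langle>h, m\<^sub>1\<rangle> = 0\<close>. Hence
  \<open>z f - \<langle>f, cnj z h\<rangle> h\<close> is orthogonal to \<open>m\<^sub>1\<close>, and it is orthogonal to \<open>h\<close> because
  \<open>\<parallel>h\<parallel> = 1\<close>. As \<open>h \<in> \<M>\<close>, the defining properties of the projection onto the orthogonal
  complement of \<open>\<M>\<close> hold (\<open>orthogonal_complement_remainder\<close>), and they determine it almost
  everywhere (\<open>projT_eqI\<close>).
\<close>

section \<open>Square-integrable functions on the circle\<close>

lemma sets_circle_measure: "sets circle_measure = sets (restrict_space borel (sphere 0 1))"
  by (simp add: circle_measure_def)

lemma finite_circle_measure: "finite_measure circle_measure"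
  by (rule finite_measureI) (simp add: space_circle_measure emeasure_circle_measure)

lemma borel_measurable_circle_measure:
  assumes "(g :: complex \<Rightarrow> complex) \<in> borel_measurable borel"
  shows "g \<in> borel_measurable circle_measure"
  using measurable_restrict_space1[OF assms]
  by (simp add: measurable_cong_sets[OF sets_circle_measure refl])

lemma borel_measurable_cnj [measurable]:
  "g \<in> borel_measurable M \<Longrightarrow> (\<lambda>z. cnj (g z)) \<in> borel_measurable M"
  by (rule borel_measurable_continuous_on) (intro continuous_intros)

lemma L2T_dominated:
  assumes "g \<in> borel_measurable circle_measure" "integrable circle_measure F"
    and "AE z in circle_measure. (norm (g z))\<^sup>2 \<le> F z"
  shows "g \<in> L2T"
proof -
  have "integrable circle_measure (\<lambda>z. (norm (g z))\<^sup>2)"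
    by (rule Bochner_Integration.integrable_bound[OF assms(2)])
       (use assms in \<open>auto elim: eventually_mono\<close>)
  then show ?thesis
    using assms(1) by (simp add: L2T_def)
qed

text \<open>
  The integrand is dominated by \<open>\<bar>f\<bar>\<^sup>2 + \<bar>g\<bar>\<^sup>2\<close>, since \<open>2ab \<le> a\<^sup>2 + b\<^sup>2\<close>.
\<close>

lemma L2T_integrable_inner:
  assumes "f \<in> L2T" "g \<in> L2T"
  shows "integrable circle_measure (\<lambda>z. f z * cnj (g z))"
proof (rule Bochner_Integration.integrable_bound)
  show "integrable circle_measure (\<lambda>z. (norm (f z))\<^sup>2 + (norm (g z))\<^sup>2)"
    using assms by (auto simp: L2T_def)
  have [measurable]: "f \<in> borel_measurable circle_measure" "g \<in> borel_measurable circle_measure"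
    using assms by (auto simp: L2T_def)
  show "(\<lambda>z. f z * cnj (g z)) \<in> borel_measurable circle_measure"
    by measurable
  have "a * b \<le> a\<^sup>2 + b\<^sup>2" if "a \<ge> 0" "b \<ge> 0" for a b :: real
    using sum_squares_bound[of a b] mult_nonneg_nonneg[OF that] by linarith
  then show "AE z in circle_measure.
      norm (f z * cnj (g z)) \<le> norm ((norm (f z))\<^sup>2 + (norm (g z))\<^sup>2)"
    by (auto simp: norm_mult)
qed

lemma L2T_add:
  assumes "f \<in> L2T" "g \<in> L2T"
  shows "(\<lambda>z. f z + g z) \<in> L2T"
proof (rule L2T_dominated)
  have [measurable]: "f \<in> borel_measurable circle_measure" "g \<in> borel_measurable circle_measure"
    using assms by (auto simp: L2T_def)
  show "(\<lambda>z. f z + g z) \<in> borel_measurable circle_measure"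
    by measurable
  show "integrable circle_measure (\<lambda>z. 2 * (norm (f z))\<^sup>2 + 2 * (norm (g z))\<^sup>2)"
    using assms by (auto simp: L2T_def)
  have "(norm (a + b))\<^sup>2 \<le> 2 * (norm a)\<^sup>2 + 2 * (norm b)\<^sup>2" for a b :: complex
  proof -
    have "(norm (a + b))\<^sup>2 \<le> (norm a + norm b)\<^sup>2"
      by (intro power_mono norm_triangle_ineq) auto
    also have "\<dots> \<le> 2 * (norm a)\<^sup>2 + 2 * (norm b)\<^sup>2"
      using sum_squares_bound[of "norm a" "norm b"] by (simp add: power2_sum)
    finally show ?thesis .
  qed
  then show "AE z in circle_measure. (norm (f z + g z))\<^sup>2 \<le> 2 * (norm (f z))\<^sup>2 + 2 * (norm (g z))\<^sup>2"
    by auto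
qed

lemma L2T_mult_bounded:
  assumes "f \<in> L2T" "\<phi> \<in> borel_measurable circle_measure"
    and "AE z in circle_measure. norm (\<phi> z) \<le> C"
  shows "(\<lambda>z. \<phi> z * f z) \<in> L2T"
proof (rule L2T_dominated)
  have [measurable]: "f \<in> borel_measurable circle_measure" "\<phi> \<in> borel_measurable circle_measure"
    using assms by (auto simp: L2T_def)
  show "(\<lambda>z. \<phi> z * f z) \<in> borel_measurable circle_measure"
    by measurable
  show "integrable circle_measure (\<lambda>z. C\<^sup>2 * (norm (f z))\<^sup>2)"
    using assms by (auto simp: L2T_def)
  show "AE z in circle_measure. (norm (\<phi> z * f z))\<^sup>2 \<le> C\<^sup>2 * (norm (f z))\<^sup>2"
    using assms(3) by eventually_elim (auto simp: norm_mult power_mult_distrib intro!: mult_right_mono power_mono)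
qed

lemma L2T_cmult: "f \<in> L2T \<Longrightarrow> (\<lambda>z. c * f z) \<in> L2T"
  by (rule L2T_mult_bounded[where C = "norm c"]) auto

lemma L2T_diff_cmult: "f \<in> L2T \<Longrightarrow> g \<in> L2T \<Longrightarrow> (\<lambda>z. f z - c * g z) \<in> L2T"
  using L2T_add[OF _ L2T_cmult, of f g "- c"] by simp

lemma AE_circle_norm: "AE z in circle_measure. norm z = 1"
  by (rule AE_I2) (simp add: space_circle_measure)

lemma L2T_mult_z: "f \<in> L2T \<Longrightarrow> (\<lambda>z. z * f z) \<in> L2T"
  by (rule L2T_mult_bounded[where C = 1])
     (use AE_circle_norm in \<open>auto intro: borel_measurable_circle_measure elim: eventually_mono\<close>)

lemma L2T_mult_cnj: "f \<in> L2T \<Longrightarrow> (\<lambda>z. cnj z * f z) \<in> L2T"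
  by (rule L2T_mult_bounded[where C = 1])
     (use AE_circle_norm in \<open>auto intro: borel_measurable_circle_measure elim: eventually_mono\<close>)

lemma L2T_one: "(\<lambda>z. 1) \<in> L2T"
  using finite_measure.integrable_const[OF finite_circle_measure] by (simp add: L2T_def)

lemma innerT_cong:
  assumes "\<And>z. norm z = 1 \<Longrightarrow> f z * cnj (g z) = f' z * cnj (g' z)"
  shows "innerT f g = innerT f' g'"
  unfolding innerT_def
  by (rule Bochner_Integration.integral_cong) (auto simp: space_circle_measure assms)

lemma innerT_diff_cmult_left:
  assumes "f \<in> L2T" "g \<in> L2T" "q \<in> L2T"
  shows "innerT (\<lambda>z. f z - c * g z) q = innerT f q - c * innerT g q"
  using L2T_integrable_inner[OF assms(1,3)] L2T_integrable_inner[OF assms(2,3)]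
  by (simp add: innerT_def left_diff_distrib mult.assoc)

lemma innerT_commute: "innerT f g = cnj (innerT g f)"
proof -
  have "innerT f g = (LINT z|circle_measure. cnj (g z * cnj (f z)))"
    by (simp add: innerT_def mult.commute)
  then show ?thesis
    by (simp only: innerT_def Bochner_Integration.integral_cnj)
qed

lemma innerT_add_cmult_right:
  assumes "f \<in> L2T" "g \<in> L2T" "q \<in> L2T"
  shows "innerT q (\<lambda>z. f z + c * g z) = innerT q f + cnj c * innerT q g"
  using innerT_diff_cmult_left[OF assms, of "- c"] innerT_commute[of q]
  by simp

lemma innerT_self: "innerT f f = of_real (LINT z|circle_measure. (norm (f z))\<^sup>2)"
  unfolding innerT_def integral_complex_of_real[symmetric] by (simp only: complex_norm_square)

lemma innerT_self_eq_1: "normT f = 1 \<Longrightarrow> innerT f f = 1"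
  by (simp add: innerT_self normT_def)

lemma innerT_self_eq_0:
  assumes "f \<in> L2T" "innerT f f = 0"
  shows "AE z in circle_measure. f z = 0"
proof -
  have "(LINT z|circle_measure. (norm (f z))\<^sup>2) = 0"
    using assms(2) by (simp add: innerT_self)
  then have "AE z in circle_measure. (norm (f z))\<^sup>2 = 0"
    using assms(1) by (subst (asm) integral_nonneg_eq_0_iff_AE) (auto simp: L2T_def)
  then show ?thesis
    by simp
qed

text \<open>
  Two candidates \<open>p\<close>, \<open>p'\<close> for the projection differ by an element of the space that is orthogonal
  to the space, hence to itself. The candidate \<open>p\<close> also serves as the witness which makes the
  choice in \<open>projT\<close> meaningful.
\<close>

lemma projT_eqI:
  assumes N: "N = L2T \<ominus>\<^sub>T M" and M: "M \<subseteq> L2T" and g: "g \<in> L2T"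
    and p: "p \<in> N" "\<And>q. q \<in> N \<Longrightarrow> innerT (\<lambda>z. g z - p z) q = 0"
  shows "eqT (projT N g) p"
proof -
  define p' where "p' = projT N g"
  have "p' \<in> N \<and> (\<forall>q\<in>N. innerT (\<lambda>z. g z - p' z) q = 0)"
    unfolding p'_def projT_def by (rule someI[of _ p]) (use p in auto)
  then have p': "p' \<in> N" "\<And>q. q \<in> N \<Longrightarrow> innerT (\<lambda>z. g z - p' z) q = 0"
    by auto
  have L: "p \<in> L2T" "p' \<in> L2T"
    using p p' N by (auto simp: orthT_def)
  define d where "d = (\<lambda>z. p' z - p z)"
  have dL: "d \<in> L2T"
    using L2T_diff_cmult[OF L(2,1), of 1] by (simp add: d_def)
  have "innerT d m = 0" if "m \<in> M" for m
    using innerT_diff_cmult_left[OF L(2,1), of m 1] p(1) p'(1) that M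
    by (auto simp: d_def N orthT_def)
  then have dN: "d \<in> N"
    using dL by (simp add: N orthT_def)
  have L': "(\<lambda>z. g z - p z) \<in> L2T" "(\<lambda>z. g z - p' z) \<in> L2T"
    using L2T_diff_cmult[OF g L(1), of 1] L2T_diff_cmult[OF g L(2), of 1] by auto
  have "innerT d d = 0"
    using innerT_diff_cmult_left[OF L' dL, of 1] p(2)[OF dN] p'(2)[OF dN]
    by (simp add: d_def)
  then have "AE z in circle_measure. d z = 0"
    by (rule innerT_self_eq_0[OF dL])
  then show ?thesis
    unfolding eqT_def p'_def[symmetric] d_def by eventually_elim simp
qed

section \<open>Values at the origin and the backward shift\<close>

lemma disk_ext_0: "disk_ext f 0 = innerT f (\<lambda>z. 1)"
  using powser_zero[of "\<lambda>n. fourierT f (int n)"] by (simp add: disk_ext_def fourierT_def)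

lemma cnj_eq_inverse_on_circle: "norm z = 1 \<Longrightarrow> cnj z = inverse z"
  using complex_norm_square[of z] by (intro inverse_unique[symmetric]) simp

text \<open>
  This function is \<open>S\<^sup>* u\<close>. It is orthogonal to \<open>u H\<^sup>2\<close> since \<open>cnj u * u = 1\<close> reduces the inner
  product with \<open>u g\<close> to the conjugate of the Fourier coefficient of \<open>g\<close> with index \<open>-1\<close>.
\<close>

lemma cnj_mult_inner_in_model_space:
  assumes u: "inner_function u" and u0: "disk_ext u 0 = 0"
  shows "(\<lambda>z. cnj z * u z) \<in> model_space u"
proof -
  have uL: "u \<in> L2T" and uF: "\<And>n. n < 0 \<Longrightarrow> fourierT u n = 0"
    and u1: "AE z in circle_measure. norm (u z) = 1"
    using u by (auto simp: inner_function_def H2_def)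
  have shift: "fourierT (\<lambda>z. cnj z * u z) n = fourierT u (n + 1)" for n
    unfolding fourierT_def
  proof (rule innerT_cong)
    fix z :: complex
    assume "norm z = 1"
    then have "z \<noteq> 0"
      by auto
    then have "z powi (n + 1) = z powi n * z"
      by (simp add: power_int_add)
    then show "cnj z * u z * cnj (z powi n) = u z * cnj (z powi (n + 1))"
      by simp
  qed
  have "fourierT (\<lambda>z. cnj z * u z) n = 0" if "n < 0" for n
  proof (cases "n = -1")
    case True
    then show ?thesis
      using u0 unfolding shift disk_ext_0 by (simp add: fourierT_def)
  next
    case False
    then show ?thesis
      using that uF[of "n + 1"] by (simp add: shift)
  qed
  then have H: "(\<lambda>z. cnj z * u z) \<in> H2"
    using L2T_mult_cnj[OF uL] by (simp add: H2_def)
  have "innerT (\<lambda>z. cnj z * u z) (\<lambda>z. u z * g z) = 0" if g: "g \<in> H2" for g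
  proof -
    have [measurable]: "u \<in> borel_measurable circle_measure" "g \<in> borel_measurable circle_measure"
      "cnj \<in> borel_measurable circle_measure"
      using uL g by (auto simp: L2T_def H2_def intro!: borel_measurable_circle_measure)
    have "innerT (\<lambda>z. cnj z * u z) (\<lambda>z. u z * g z) = innerT (\<lambda>z. cnj z) g"
      unfolding innerT_def
    proof (rule Bochner_Integration.integral_cong_AE)
      show "AE z in circle_measure. cnj z * u z * cnj (u z * g z) = cnj z * cnj (g z)"
        using u1
      proof eventually_elim
        case (elim z)
        then have "u z * cnj (u z) = 1"
          by (simp add: complex_norm_square[symmetric])
        moreover have "cnj z * u z * cnj (u z * g z) = (u z * cnj (u z)) * (cnj z * cnj (g z))"
          by simp
        ultimately show ?case
          by simp
      qed
    qed measurable
    also have "\<dots> = innerT (\<lambda>z. z powi (-1)) g"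
      by (rule innerT_cong) (simp add: cnj_eq_inverse_on_circle power_int_minus)
    also have "\<dots> = cnj (fourierT g (-1))"
      unfolding fourierT_def by (rule innerT_commute)
    also have "\<dots> = 0"
      using g by (simp add: H2_def)
    finally show ?thesis .
  qed
  then show ?thesis
    using H by (auto simp: model_space_def orthT_def)
qed

lemma innerT_backward_shift:
  assumes "disk_ext m 0 = 0"
  shows "innerT f (backward_shift m) = innerT (\<lambda>z. z * f z) m"
  by (rule innerT_cong)
     (simp add: backward_shift_def assms divide_inverse cnj_eq_inverse_on_circle[symmetric])

section \<open>The projection of z f\<close>

text \<open>
  This holds because \<open>\<langle>f, cnj z h\<rangle> h\<close> is the projection of \<open>z f\<close> onto \<open>M\<close>: on the elements of \<open>M\<close>
  vanishing at the origin near invariance and extremality apply separately to the two terms, and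
  \<open>h\<close> spans a complement of these elements in \<open>M\<close>.
\<close>

lemma orthogonal_complement_remainder:
  assumes near: "nearly_invariant M" and ext: "extremal_function M h"
    and f: "f \<in> L2T \<ominus>\<^sub>T M"
  shows "(\<lambda>z. z * f z - innerT f (\<lambda>w. cnj w * h w) * h z) \<in> L2T \<ominus>\<^sub>T M"
proof -
  define a where "a = innerT f (\<lambda>w. cnj w * h w)"
  have cs: "closed_subspaceT M" and M: "M \<subseteq> L2T"
    using near by (auto simp: nearly_invariant_def closed_subspaceT_def)
  have h: "h \<in> M" "innerT h h = 1" "disk_ext h 0 \<noteq> 0"
    using ext by (auto simp: extremal_function_def innerT_self_eq_1)
  have hL: "h \<in> L2T" and fL: "f \<in> L2T"
    using h M f by (auto simp: orthT_def)
  define p where "p = (\<lambda>z. z * f z - a * h z)"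
  have pL: "p \<in> L2T"
    unfolding p_def by (intro L2T_diff_cmult L2T_mult_z fL hL)
  have expand: "innerT p q = innerT (\<lambda>z. z * f z) q - a * innerT h q" if "q \<in> L2T" for q
    unfolding p_def by (intro innerT_diff_cmult_left L2T_mult_z fL hL that)
  have "a = innerT (\<lambda>z. z * f z) h"
    unfolding a_def by (rule innerT_cong) simp
  then have ph: "innerT p h = 0"
    using expand[OF hL] h(2) by simp
  have "innerT p m = 0" if m: "m \<in> M" for m
  proof -
    define c where "c = disk_ext m 0 / disk_ext h 0"
    define m\<^sub>1 where "m\<^sub>1 = (\<lambda>z. m z + (- c) * h z)"
    have m1: "m\<^sub>1 \<in> M"
    proof -
      have "(\<lambda>z. (- c) * h z) \<in> M"
        using cs h(1) by (simp only: closed_subspaceT_def)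
      then show ?thesis
        using cs m by (simp only: closed_subspaceT_def m\<^sub>1_def)
    qed
    have m1L: "m\<^sub>1 \<in> L2T"
      using m1 M by blast
    have mL: "m \<in> L2T"
      using m M by blast
    have m10: "disk_ext m\<^sub>1 0 = 0"
      using innerT_diff_cmult_left[OF mL hL L2T_one, of c] h(3)
      unfolding disk_ext_0 by (simp add: m\<^sub>1_def c_def disk_ext_0)
    have "backward_shift m\<^sub>1 \<in> M"
      using near m1 m10 by (simp add: nearly_invariant_def)
    then have "innerT (\<lambda>z. z * f z) m\<^sub>1 = 0"
      using f innerT_backward_shift[OF m10, of f] by (simp add: orthT_def)
    moreover have "innerT h m\<^sub>1 = 0"
      using ext m1 m10 by (simp add: extremal_function_def)
    ultimately have "innerT p m\<^sub>1 = 0"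
      using expand[OF m1L] by simp
    moreover have "m = (\<lambda>z. m\<^sub>1 z + c * h z)"
      by (simp add: m\<^sub>1_def)
    ultimately show ?thesis
      using innerT_add_cmult_right[OF m1L hL pL, of c] ph by simp
  qed
  then show ?thesis
    using pL by (simp add: orthT_def p_def a_def)
qed

theorem proposition5p3:
  fixes M :: "(complex \<Rightarrow> complex) set" and h u f :: "complex \<Rightarrow> complex"
  assumes "nearly_invariant M"
    and "hK_representation M h u"
    and "f \<in> L2T \<ominus>\<^sub>T M"
  shows "eqT (dual_shift M f)
           (\<lambda>z. z * f z
                - innerT f (\<lambda>w. cnj w * h w) * h z
                + innerT f (\<lambda>w. cnj w * h w * u w) * (h z * u z))"
proof -
  have ext: "extremal_function M h" and M: "M \<subseteq> L2T"
    and u: "inner_function u" "disk_ext u 0 = 0"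
    and mult: "\<And>k. k \<in> model_space u \<Longrightarrow> (\<lambda>z. h z * k z) \<in> M"
    using assms(2) by (auto simp: hK_representation_def closed_subspaceT_def)
  have h: "h \<in> M"
    using ext by (simp add: extremal_function_def)
  have fL: "f \<in> L2T"
    using assms(3) by (simp add: orthT_def)
  have "(\<lambda>w. h w * (cnj w * u w)) \<in> M"
    by (intro mult cnj_mult_inner_in_model_space u)
  then have "(\<lambda>w. cnj w * h w * u w) \<in> M"
    by (simp add: mult_ac)
  then have last_term: "innerT f (\<lambda>w. cnj w * h w * u w) = 0"
    using assms(3) by (simp add: orthT_def)
  define a where "a = innerT f (\<lambda>w. cnj w * h w)"
  have "eqT (dual_shift M f) (\<lambda>z. z * f z - a * h z)"
    unfolding dual_shift_def
  proof (rule projT_eqI[OF refl M L2T_mult_z[OF fL]])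
    show "(\<lambda>z. z * f z - a * h z) \<in> L2T \<ominus>\<^sub>T M"
      unfolding a_def by (rule orthogonal_complement_remainder[OF assms(1) ext assms(3)])
  next
    fix q assume "q \<in> L2T \<ominus>\<^sub>T M"
    then have "innerT h q = 0"
      using h innerT_commute[of h q] by (simp add: orthT_def)
    then show "innerT (\<lambda>z. z * f z - (z * f z - a * h z)) q = 0"
      by (simp add: innerT_def mult.assoc)
  qed
  then show ?thesis
    by (simp add: last_term a_def)
qed

end
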